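(* Let $n\ge1$, and let $p,a,b$ be real numbers with $\frac12\le p\le2$, $a\ge0$, $b\ge0$ and $a+b\ge1$. Let each of $K$ and $L$ be a smooth uniformly h-convex bounded domain in $\mathbb{H}^{n+1}$ or a single point of $\mathbb{H}^{n+1}$, and let $\Omega=a\cdot K+_p^{\mathcal H}b\cdot L$ be their hyperbolic $p$-sum. Then $$\pi(\Omega)=a\cdot\pi(K)+_p^{\mathcal R}b\cdot\pi(L),$$ where $+_p^{\mathcal R}$ is the Minkowski–Firey $L_p$-addition in $\mathbb{R}^{n+1}$.
   Context: $\mathbb{R}^{n+1,1}$ is $\mathbb{R}^{n+2}$ with $\langle X,Y\rangle=\sum_{i=0}^nx_iy_i-x_{n+1}y_{n+1}$; $\mathbb{H}^{n+1}=\{X=(x,x_{n+1}):x\in\mathbb{R}^{n+1},\langle X,X\rangle=-1,x_{n+1}>0\}$; $\mathbb{S}^n\subset\mathbb{R}^{n+1}$ is the unit sphere. Closed horo-balls are $\{X\in\mathbb{H}^{n+1}:\log(-\langle X,(z,1)\rangle)\le s\}$, $z\in\mathbb{S}^n$, $s\in\mathbb{R}$; an h-convex bounded domain is a nonempty bounded intersection of closed horo-balls (a point is allowed as a degenerate case); a smooth bounded domain is uniformly h-convex if for some $\delta>0$ all principal curvatures of its boundary (outward normal) exceed $1+\delta$. Horospherical support function: $u_\Omega(z)=\sup_{X\in\Omega}\log(-\langle X,(z,1)\rangle)$. Hyperbolic $p$-sum: $a\cdot K+_p^{\mathcal H}b\cdot L$ is the (unique) h-convex bounded domain with horospherical support function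 $\frac1p\log(ae^{pu_K}+be^{pu_L})$. The map $\pi$: for a set $\Omega\subset\mathbb{H}^{n+1}$, $\pi(\Omega)=\bigcup_{X=(x,x_{n+1})\in\Omega}\widehat B(-x,x_{n+1})\subset\mathbb{R}^{n+1}$, where $\widehat B(y,\rho)$ is the closed Euclidean ball of center $y$ and radius $\rho$. Firey sum: for convex bodies $\widehat K,\widehat L\subset\mathbb{R}^{n+1}$ containing the origin in their interiors, with support functions $\widehat u(z)=\max_{x}\langle x,z\rangle$: if $p\ge1$, $a\cdot\widehat K+_p^{\mathcal R}b\cdot\widehat L$ is the convex body with support function $\left(a\widehat u_{\widehat K}^p+b\widehat u_{\widehat L}^p\right)^{1/p}$; if $0<p<1$, it is $\bigcap_{z\in\mathbb{S}^n}\left\{x\in\mathbb{R}^{n+1}:\langle x,z\rangle\le\left(a\widehat u_{\widehat K}^p(z)+b\widehat u_{\widehat L}^p(z)\right)^{1/p}\right\}$. *)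

theory Defs
  imports "HOL-Analysis.Analysis"
begin

text \<open>The Euclidean space \<open>\<real>\<^sup>n\<^sup>+\<^sup>1\<close> is a type \<open>'a\<close> of class \<open>euclidean_space\<close>, and
  \<open>\<real>\<^sup>n\<^sup>+\<^sup>1\<^sup>,\<^sup>1\<close> is \<open>'a \<times> real\<close>, the last (timelike) coordinate being the second component.\<close>

definition mink :: "'a::euclidean_space \<times> real \<Rightarrow> 'a \<times> real \<Rightarrow> real" where
  "mink X Y = fst X \<bullet> fst Y - snd X * snd Y"

definition hyp_space :: "('a::euclidean_space \<times> real) set" where
  "hyp_space = {X. mink X X = -1 \<and> snd X > 0}"

definition horoball :: "'a::euclidean_space \<Rightarrow> real \<Rightarrow> ('a \<times> real) set" where
  "horoball z s = {X \<in> hyp_space. ln (- mink X (z, 1)) \<le> s}"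

text \<open>A subset of the hyperboloid is bounded for the hyperbolic distance iff it is bounded in the
  ambient Euclidean norm, since the distance of \<open>X\<close> to \<open>(0, 1)\<close> is \<open>arcosh (snd X)\<close>.\<close>

definition h_convex_bounded_domain :: "('a::euclidean_space \<times> real) set \<Rightarrow> bool" where
  "h_convex_bounded_domain \<Omega> \<longleftrightarrow>
     \<Omega> \<noteq> {} \<and> bounded \<Omega> \<and>
     (\<exists>F \<subseteq> sphere 0 1 \<times> UNIV. \<Omega> = hyp_space \<inter> (\<Inter>(z, s)\<in>F. horoball z s))"

definition horo_support :: "('a::euclidean_space \<times> real) set \<Rightarrow> 'a \<Rightarrow> real" where
  "horo_support \<Omega> z = (SUP X\<in>\<Omega>. ln (- mink X (z, 1)))"

definition hyp_p_sum ::
  "real \<Rightarrow> real \<Rightarrow> ('a::euclidean_space \<times> real) set \<Rightarrow> real \<Rightarrow> ('a \<times> real) set \<Rightarrow> ('a \<times> real) set" where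
  "hyp_p_sum p a K b L =
     (THE \<Omega>. h_convex_bounded_domain \<Omega> \<and>
       (\<forall>z\<in>sphere 0 1. horo_support \<Omega> z =
          1 / p * ln (a * exp (p * horo_support K z) + b * exp (p * horo_support L z))))"

primrec Ck_on :: "nat \<Rightarrow> 'v::real_normed_vector set \<Rightarrow> ('v \<Rightarrow> 'w::real_normed_vector) \<Rightarrow> bool" where
  "Ck_on 0 U f \<longleftrightarrow> continuous_on U f"
| "Ck_on (Suc k) U f \<longleftrightarrow>
     f differentiable_on U \<and> (\<forall>v. Ck_on k U (\<lambda>x. frechet_derivative f (at x) v))"

text \<open>Only used for open \<open>U\<close> in finite dimension, where directional derivatives suffice.\<close>

definition smooth_on :: "'v::euclidean_space set \<Rightarrow> ('v \<Rightarrow> 'w::real_normed_vector) \<Rightarrow> bool" where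
  "smooth_on U f \<longleftrightarrow> (\<forall>k. Ck_on k U f)"

text \<open>The tangent space of \<open>hyp_space\<close> at \<open>X\<close> is \<open>{v. mink X v = 0}\<close>; the last conjunct says that
  \<open>0\<close> is a regular value of the restriction of \<open>f\<close> to \<open>hyp_space \<inter> U\<close>.\<close>

definition local_defining_function ::
  "('a::euclidean_space \<times> real) set \<Rightarrow> ('a \<times> real) set \<Rightarrow> ('a \<times> real \<Rightarrow> real) \<Rightarrow> bool" where
  "local_defining_function \<Omega> U f \<longleftrightarrow>
     open U \<and> smooth_on U f \<and> \<Omega> \<inter> U = {X \<in> hyp_space \<inter> U. f X \<le> 0} \<and>
     (\<forall>X\<in>hyp_space \<inter> U. f X = 0 \<longrightarrow>
        (\<exists>v. mink X v = 0 \<and> frechet_derivative f (at X) v \<noteq> 0))"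

text \<open>Domains are taken closed, so that a smooth bounded domain is a compact connected region with
  smooth boundary. At interior points a negative constant is a local defining function.\<close>

definition smooth_bounded_domain :: "('a::euclidean_space \<times> real) set \<Rightarrow> bool" where
  "smooth_bounded_domain \<Omega> \<longleftrightarrow>
     \<Omega> \<subseteq> hyp_space \<and> \<Omega> \<noteq> {} \<and> compact \<Omega> \<and> connected \<Omega> \<and>
     (\<forall>X\<in>\<Omega>. \<exists>U f. X \<in> U \<and> local_defining_function \<Omega> U f)"

definition hyp_boundary :: "('a::euclidean_space \<times> real) set \<Rightarrow> ('a \<times> real) set" where
  "hyp_boundary \<Omega> = (top_of_set hyp_space) frontier_of \<Omega>"

text \<open>\<open>\<nu>\<close> is the normalised gradient, in \<open>hyp_space\<close>, of a local defining function (which is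
  nonpositive inside \<open>\<Omega>\<close>); it does not depend on that function.\<close>

definition outward_unit_normal ::
  "('a::euclidean_space \<times> real) set \<Rightarrow> 'a \<times> real \<Rightarrow> 'a \<times> real \<Rightarrow> bool" where
  "outward_unit_normal \<Omega> X \<nu> \<longleftrightarrow>
     X \<in> hyp_boundary \<Omega> \<and> mink X \<nu> = 0 \<and> mink \<nu> \<nu> = 1 \<and>
     (\<exists>U f c. X \<in> U \<and> local_defining_function \<Omega> U f \<and> c > 0 \<and>
        (\<forall>v. mink X v = 0 \<longrightarrow> frechet_derivative f (at X) v = c * mink \<nu> v))"

text \<open>Eigenvalues of the shape operator \<open>v \<mapsto> \<nabla>\<^sub>v N\<close> of the boundary, \<open>N\<close> being the outward unit
  normal field, extended smoothly to a neighbourhood in \<open>\<real>\<^sup>n\<^sup>+\<^sup>1\<^sup>,\<^sup>1\<close>. The flat derivative of \<open>N\<close> in a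
  direction \<open>v\<close> tangent to \<open>hyp_space\<close> is \<open>\<nabla>\<^sub>v N + mink (N X) v *\<^sub>R X\<close>, so for \<open>v\<close> tangent to the
  boundary it is the Levi-Civita derivative of \<open>hyp_space\<close>. With this sign geodesic spheres
  have positive and horospheres have unit principal curvatures.\<close>

definition principal_curvature ::
  "('a::euclidean_space \<times> real) set \<Rightarrow> 'a \<times> real \<Rightarrow> real \<Rightarrow> bool" where
  "principal_curvature \<Omega> X \<kappa> \<longleftrightarrow>
     (\<exists>U N v. X \<in> U \<inter> hyp_boundary \<Omega> \<and> open U \<and> smooth_on U N \<and>
        (\<forall>Y\<in>U \<inter> hyp_boundary \<Omega>. outward_unit_normal \<Omega> Y (N Y)) \<and>
        v \<noteq> 0 \<and> mink X v = 0 \<and> mink (N X) v = 0 \<and>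
        frechet_derivative N (at X) v = \<kappa> *\<^sub>R v)"

definition uniformly_h_convex :: "('a::euclidean_space \<times> real) set \<Rightarrow> bool" where
  "uniformly_h_convex \<Omega> \<longleftrightarrow>
     (\<exists>\<delta>>0. \<forall>X\<in>hyp_boundary \<Omega>. \<forall>\<kappa>. principal_curvature \<Omega> X \<kappa> \<longrightarrow> \<kappa> > 1 + \<delta>)"

definition pi_map :: "('a::euclidean_space \<times> real) set \<Rightarrow> 'a set" where
  "pi_map \<Omega> = (\<Union>(x, t)\<in>\<Omega>. cball (- x) t)"

definition convex_body :: "'a::euclidean_space set \<Rightarrow> bool" where
  "convex_body C \<longleftrightarrow> C \<noteq> {} \<and> compact C \<and> convex C"

definition support_fun :: "'a::euclidean_space set \<Rightarrow> 'a \<Rightarrow> real" where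
  "support_fun C z = (SUP x\<in>C. x \<bullet> z)"

text \<open>Meant for \<open>p > 0\<close> and convex bodies containing the origin in their interiors.\<close>

definition firey_sum ::
  "real \<Rightarrow> real \<Rightarrow> 'a::euclidean_space set \<Rightarrow> real \<Rightarrow> 'a set \<Rightarrow> 'a set" where
  "firey_sum p a K b L =
     (if p \<ge> 1
      then (THE C. convex_body C \<and>
              (\<forall>z\<in>sphere 0 1. support_fun C z =
                 (a * support_fun K z powr p + b * support_fun L z powr p) powr (1 / p)))
      else (\<Inter>z\<in>sphere 0 1.
              {x. x \<bullet> z \<le> (a * support_fun K z powr p + b * support_fun L z powr p) powr (1 / p)}))"

end

theory Submission
  imports Defs
begin

text \<open>Put \<open>\<phi>\<^sub>K = exp u\<^sub>K\<close>; this is the Euclidean support function of \<open>\<pi>(K)\<close>. The horo-convex Wulff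
  shape \<open>\<Omega>\<close> of \<open>\<phi> = (a \<phi>\<^sub>K\<^sup>p + b \<phi>\<^sub>L\<^sup>p)\<^sup>1\<^sup>/\<^sup>p\<close> is the hyperbolic sum once it touches
  all the horospheres \<open>-\<langle>X,(c,1)\<rangle> = \<phi>(c)\<close>. As \<open>\<phi>\<close> is increasing in \<open>\<phi>\<^sub>K\<close> and \<open>\<phi>\<^sub>L\<close>, replacing \<open>K\<close> and \<open>L\<close> by contact points in direction
  \<open>c\<close> reduces this to two points, where it is an explicit inequality in horospherical coordinates at
  \<open>c\<close>: Jensen's inequality for the square of a norm if \<open>p \<ge> 1\<close>, the triangle inequality for the norm
  if \<open>p \<le> 1\<close> (with exponent \<open>2p \<ge> 1\<close>).

  Moreover \<open>\<pi>(\<Omega>)\<close> is convex: it is star-shaped about \<open>0\<close>, and it contains every exposed face of its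
  convex hull, because in horospherical coordinates the contact set of \<open>\<Omega>\<close> with a horosphere is convex
  and \<open>\<pi>\<close> acts on it affinely. So \<open>\<pi>(\<Omega>)\<close> is the convex body with support function \<open>\<phi>\<close>.\<close>

section \<open>Horospherical coordinates on the hyperboloid\<close>

text \<open>The exponential of the Busemann function of the ideal point \<open>z\<close>.\<close>

definition busexp :: "'a::euclidean_space \<Rightarrow> 'a \<times> real \<Rightarrow> real" where
  "busexp z X = snd X - fst X \<bullet> z"

definition tang :: "'a::euclidean_space \<Rightarrow> 'a \<Rightarrow> 'a" where
  "tang z x = x - (x \<bullet> z) *\<^sub>R z"

lemma mink_null: "- mink X (z, 1) = busexp z X"
  by (simp add: mink_def busexp_def)

lemma hyp_space_iff: "X \<in> hyp_space \<longleftrightarrow> (snd X)\<^sup>2 = 1 + fst X \<bullet> fst X \<and> snd X > 0"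
  unfolding hyp_space_def mink_def power2_eq_square mem_Collect_eq by linarith

lemma norm_lt_snd:
  assumes "X \<in> hyp_space" shows "norm (fst X) < snd X"
proof -
  have "(norm (fst X))\<^sup>2 < (snd X)\<^sup>2"
    using assms by (simp add: hyp_space_iff power2_norm_eq_inner)
  then show ?thesis
    by (rule power_less_imp_less_base) (use assms in \<open>simp add: hyp_space_iff\<close>)
qed

lemma busexp_pos:
  assumes "X \<in> hyp_space" "norm z = 1" shows "busexp z X > 0"
proof -
  have "fst X \<bullet> z \<le> norm (fst X)" using norm_cauchy_schwarz[of "fst X" z] assms(2) by simp
  then show ?thesis using norm_lt_snd[OF assms(1)] by (simp add: busexp_def)
qed

text \<open>In the half-space model with \<open>c\<close> at infinity, \<open>X\<close> has height \<open>1 / busexp c X\<close> above the point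
  \<open>tang c (fst X) /\<^sub>R busexp c X\<close>, and the ideal point \<open>z\<close> is \<open>tang c z /\<^sub>R (1 - z \<bullet> c)\<close>.\<close>

lemma busexp_coordinates:
  fixes z c :: "'a::euclidean_space"
  assumes X: "X \<in> hyp_space" and z: "norm z = 1" and c: "norm c = 1"
  shows "2 * (1 - z \<bullet> c) * busexp z X / busexp c X =
    (norm (tang c z - ((1 - z \<bullet> c) / busexp c X) *\<^sub>R tang c (fst X)))\<^sup>2 + ((1 - z \<bullet> c) / busexp c X)\<^sup>2"
proof -
  define s where "s = busexp c X"
  have s: "s > 0" using busexp_pos[OF X c] by (simp add: s_def)
  have zz: "z \<bullet> z = 1" and cc: "c \<bullet> c = 1" using z c by (simp_all add: norm_eq_1)
  let ?x = "fst X" and ?t = "snd X"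
  have xx: "?x \<bullet> ?x = ?t\<^sup>2 - 1" using X by (simp add: hyp_space_iff)
  have 1: "tang c z \<bullet> tang c z = 1 - (z \<bullet> c)\<^sup>2"
    by (simp add: tang_def inner_diff zz cc inner_commute power2_eq_square algebra_simps)
  have 2: "tang c ?x \<bullet> tang c ?x = ?t\<^sup>2 - 1 - (?x \<bullet> c)\<^sup>2"
    by (simp add: tang_def inner_diff xx cc inner_commute power2_eq_square algebra_simps)
  have 3: "tang c z \<bullet> tang c ?x = ?x \<bullet> z - (z \<bullet> c) * (?x \<bullet> c)"
    by (simp add: tang_def inner_diff xx cc inner_commute power2_eq_square algebra_simps)
  define r where "r = (1 - z \<bullet> c) / s"
  have rs: "1 - z \<bullet> c = r * s" using s by (simp add: r_def)
  have zc: "z \<bullet> c = 1 - r * s" using rs by simp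
  have st: "?t = s + ?x \<bullet> c" by (simp add: s_def busexp_def)
  have "(norm (tang c z - r *\<^sub>R tang c ?x))\<^sup>2 + r\<^sup>2
      = 1 - (z \<bullet> c)\<^sup>2 - 2 * r * (?x \<bullet> z - (z \<bullet> c) * (?x \<bullet> c)) + r\<^sup>2 * (?t\<^sup>2 - 1 - (?x \<bullet> c)\<^sup>2) + r\<^sup>2"
    unfolding 1[symmetric] 2[symmetric] 3[symmetric] power2_norm_eq_inner
    by (simp add: inner_diff inner_commute power2_eq_square algebra_simps)
  also have "\<dots> = 2 * r * (?t - ?x \<bullet> z)"
    unfolding zc st by (simp add: power2_eq_square algebra_simps)
  also have "\<dots> = 2 * (1 - z \<bullet> c) * busexp z X / s"
    by (simp add: r_def busexp_def)
  finally show ?thesis by (simp add: s_def r_def)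
qed

lemma horo_point_exists:
  fixes c y :: "'a::euclidean_space"
  assumes c: "norm c = 1" and y: "y \<bullet> c = 0" and s: "s > 0"
  obtains X where "X \<in> hyp_space" "busexp c X = s" "tang c (fst X) = y"
proof -
  \<comment> \<open>The ansatz \<open>(y + r *\<^sub>R c, r + s)\<close> already has
    \<open>busexp\<close> equal to \<open>s\<close> at \<open>c\<close> and tangential part
    \<open>y\<close>. In the hyperboloid equation the squares of \<open>r\<close> cancel, and this
    is the solution of the remaining linear equation.\<close>
  define r where "r = ((1 + y \<bullet> y) / s - s) / 2"
  define X where "X = (y + r *\<^sub>R c, r + s)"
  have cc: "c \<bullet> c = 1" using c by (simp add: norm_eq_1)
  have rs: "2 * r * s = 1 + y \<bullet> y - s\<^sup>2"
    using s by (simp add: r_def field_simps power2_eq_square)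
  have "r + s = ((1 + y \<bullet> y) / s + s) / 2" by (simp add: r_def field_simps)
  moreover have "(1 + y \<bullet> y) / s > 0" using s by (simp add: add_pos_nonneg)
  ultimately have "r + s > 0" using s by (simp add: add_pos_pos)
  moreover have "(r + s)\<^sup>2 = 1 + (y + r *\<^sub>R c) \<bullet> (y + r *\<^sub>R c)"
    using rs by (simp add: inner_add cc y inner_commute[of c y] power2_eq_square algebra_simps)
  ultimately have "X \<in> hyp_space" by (simp add: hyp_space_iff X_def)
  moreover have "busexp c X = s" "tang c (fst X) = y"
    by (simp_all add: X_def busexp_def tang_def inner_add cc y)
  ultimately show thesis using that by blast
qed

lemma tang_orthogonal: "norm c = 1 \<Longrightarrow> tang c x \<bullet> c = 0"
  by (simp add: tang_def inner_diff norm_eq_1)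

text \<open>Equality case of Cauchy-Schwarz. It makes the scaling factor
  \<open>1 - z \<bullet> c\<close> positive for every ideal point \<open>z\<close> other than
  \<open>c\<close>.\<close>

lemma unit_inner_eq_1:
  assumes "norm z = 1" "norm c = 1" "z \<bullet> c \<ge> 1" shows "z = c"
proof -
  have "(norm (z - c))\<^sup>2 \<le> 0"
    using assms by (simp add: power2_norm_eq_inner inner_diff inner_commute norm_eq_1)
  then show ?thesis by simp
qed

section \<open>Means of two points in horospherical coordinates\<close>

lemma norm_convex_comb_sq:
  fixes u v :: "'a::euclidean_space"
  assumes "m1 \<ge> 0" "m2 \<ge> 0" "m1 + m2 = 1"
  shows "(norm (m1 *\<^sub>R u + m2 *\<^sub>R v))\<^sup>2 \<le> m1 * (norm u)\<^sup>2 + m2 * (norm v)\<^sup>2"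
proof -
  have m: "m1 = 1 - m2" using assms by simp
  have "m1 * (norm u)\<^sup>2 + m2 * (norm v)\<^sup>2 - (norm (m1 *\<^sub>R u + m2 *\<^sub>R v))\<^sup>2 = m1 * m2 * (norm (u - v))\<^sup>2"
    unfolding m power2_norm_eq_inner
    by (simp add: inner_add inner_diff inner_commute algebra_simps)
  moreover have "m1 * m2 * (norm (u - v))\<^sup>2 \<ge> 0" using assms by simp
  ultimately show ?thesis by linarith
qed

text \<open>The point \<open>X\<close> lies on a prescribed horosphere at \<open>c\<close>, above the weighted mean of the feet of
  \<open>X1\<close> and \<open>X2\<close>. The hypotheses on \<open>s\<close> say that its height is at most the quadratic, respectively
  arithmetic, mean of their heights.\<close>

lemma horo_mean_points:
  fixes c :: "'a::euclidean_space"
  assumes X1: "X1 \<in> hyp_space" and X2: "X2 \<in> hyp_space" and c: "norm c = 1"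
    and m: "m1 \<ge> 0" "m2 \<ge> 0" "m1 + m2 = 1" and s: "s > 0"
  obtains X where "X \<in> hyp_space" "busexp c X = s"
    "tang c (fst X) =
       s *\<^sub>R ((m1 / busexp c X1) *\<^sub>R tang c (fst X1) + (m2 / busexp c X2) *\<^sub>R tang c (fst X2))"
    "\<And>z. \<lbrakk>1 / s\<^sup>2 \<le> m1 / (busexp c X1)\<^sup>2 + m2 / (busexp c X2)\<^sup>2; norm z = 1\<rbrakk> \<Longrightarrow>
       busexp z X / s \<le> m1 * (busexp z X1 / busexp c X1) + m2 * (busexp z X2 / busexp c X2)"
    "\<And>z. \<lbrakk>1 / s \<le> m1 / busexp c X1 + m2 / busexp c X2; norm z = 1\<rbrakk> \<Longrightarrow>
       sqrt (busexp z X / s) \<le>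
         m1 * sqrt (busexp z X1 / busexp c X1) + m2 * sqrt (busexp z X2 / busexp c X2)"
proof -
  define s1 where "s1 = busexp c X1"
  define s2 where "s2 = busexp c X2"
  define w1 where "w1 = (1 / s1) *\<^sub>R tang c (fst X1)"
  define w2 where "w2 = (1 / s2) *\<^sub>R tang c (fst X2)"
  define w where "w = m1 *\<^sub>R w1 + m2 *\<^sub>R w2"
  have s12: "s1 > 0" "s2 > 0" using busexp_pos[OF X1 c] busexp_pos[OF X2 c] by (simp_all add: s1_def s2_def)
  have "(s *\<^sub>R w) \<bullet> c = 0"
    by (simp add: w_def w1_def w2_def inner_add tang_orthogonal[OF c])
  from horo_point_exists[OF c this s] obtain X where
    X: "X \<in> hyp_space" and Xs: "busexp c X = s" and Xt: "tang c (fst X) = s *\<^sub>R w" .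
  \<comment> \<open>For \<open>n = 1 - z \<bullet> c > 0\<close> the norm of this pair is
    \<open>n\<close> times the Euclidean distance, in the half-space model, from the ideal point
    \<open>z\<close> to the point with foot \<open>u\<close> and height \<open>1 / h\<close>. Thus
    \<open>busexp_coordinates\<close> becomes a formula for a squared norm.\<close>
  define v where "v n z u h = (tang c z - n *\<^sub>R u, n / h)" for n z and u :: 'a and h :: real
  have nv: "2 * (1 - z \<bullet> c) * (busexp z Y / busexp c Y) =
      (norm (v (1 - z \<bullet> c) z ((1 / busexp c Y) *\<^sub>R tang c (fst Y)) (busexp c Y)))\<^sup>2"
    if "Y \<in> hyp_space" "norm z = 1" for Y z
    using busexp_coordinates[OF that c] by (simp add: v_def norm_Pair power_divide)
  have n1: "2 * (1 - z \<bullet> c) * (busexp z X1 / s1) = (norm (v (1 - z \<bullet> c) z w1 s1))\<^sup>2"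
    and n2: "2 * (1 - z \<bullet> c) * (busexp z X2 / s2) = (norm (v (1 - z \<bullet> c) z w2 s2))\<^sup>2"
    and n0: "2 * (1 - z \<bullet> c) * (busexp z X / s) = (norm (v (1 - z \<bullet> c) z w s))\<^sup>2" if "norm z = 1" for z
    using nv[OF X1 that] nv[OF X2 that] nv[OF X that] s
    by (simp_all add: s1_def[symmetric] s2_def[symmetric] w1_def[symmetric] w2_def[symmetric] Xs Xt)
  have npos: "1 - z \<bullet> c > 0" if "norm z = 1" "z \<noteq> c" for z
    using unit_inner_eq_1[OF that(1) c] that(2) by force
  have comb: "m1 *\<^sub>R (tang c z - n *\<^sub>R w1) + m2 *\<^sub>R (tang c z - n *\<^sub>R w2) = tang c z - n *\<^sub>R w" for z n
  proof -
    have "m1 *\<^sub>R tang c z + m2 *\<^sub>R tang c z = tang c z"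
      using m(3) by (simp add: scaleR_left_distrib[symmetric])
    then show ?thesis by (simp add: w_def algebra_simps)
  qed
  have A: "busexp z X / s \<le> m1 * (busexp z X1 / s1) + m2 * (busexp z X2 / s2)"
    if h: "1 / s\<^sup>2 \<le> m1 / s1\<^sup>2 + m2 / s2\<^sup>2" and z: "norm z = 1" for z
  proof (cases "z = c")
    \<comment> \<open>Here \<open>z\<close> is the point at infinity, where the coordinate formula
      reads \<open>0 = 0\<close>; but all the quotients equal 1.\<close>
    case True
    then show ?thesis using Xs s s12 m by (simp add: s1_def[symmetric] s2_def[symmetric])
  next
    case False
    define n where "n = 1 - z \<bullet> c"
    have n: "n > 0" using npos[OF z False] by (simp add: n_def)
    have "2 * n * (busexp z X / s) = (norm (tang c z - n *\<^sub>R w))\<^sup>2 + n\<^sup>2 * (1 / s\<^sup>2)"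
      using n0[OF z] by (simp add: n_def v_def norm_Pair power_divide)
    \<comment> \<open>Jensen's inequality handles the horizontal component, the hypothesis
      \<open>h\<close> the vertical one.\<close>
    also have "\<dots> \<le> (m1 * (norm (tang c z - n *\<^sub>R w1))\<^sup>2 + m2 * (norm (tang c z - n *\<^sub>R w2))\<^sup>2)
        + n\<^sup>2 * (m1 / s1\<^sup>2 + m2 / s2\<^sup>2)"
      using norm_convex_comb_sq[OF m, of "tang c z - n *\<^sub>R w1" "tang c z - n *\<^sub>R w2"] comb[of z n] h
      by (intro add_mono mult_left_mono) auto
    also have "\<dots> = m1 * (norm (v n z w1 s1))\<^sup>2 + m2 * (norm (v n z w2 s2))\<^sup>2"
      by (simp add: v_def norm_Pair power_divide algebra_simps)
    also have "\<dots> = 2 * n * (m1 * (busexp z X1 / s1) + m2 * (busexp z X2 / s2))"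
      unfolding n1[OF z, folded n_def, symmetric] n2[OF z, folded n_def, symmetric]
      by (simp add: algebra_simps)
    finally show ?thesis by (rule mult_left_le_imp_le) (use n in simp)
  qed
  have B: "sqrt (busexp z X / s) \<le> m1 * sqrt (busexp z X1 / s1) + m2 * sqrt (busexp z X2 / s2)"
    if h: "1 / s \<le> m1 / s1 + m2 / s2" and z: "norm z = 1" for z
  proof (cases "z = c")
    case True
    then show ?thesis using Xs s s12 m by (simp add: s1_def[symmetric] s2_def[symmetric])
  next
    case False
    define n where "n = 1 - z \<bullet> c"
    have n: "n > 0" using npos[OF z False] by (simp add: n_def)
    have sq: "sqrt (2 * n) * sqrt (busexp z X / s) = norm (v n z w s)"
      "sqrt (2 * n) * sqrt (busexp z X1 / s1) = norm (v n z w1 s1)"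
      "sqrt (2 * n) * sqrt (busexp z X2 / s2) = norm (v n z w2 s2)"
      unfolding real_sqrt_mult[symmetric] n_def using n0[OF z] n1[OF z] n2[OF z] by simp_all
    have hn: "n / s \<le> m1 * (n / s1) + m2 * (n / s2)"
      using mult_left_mono[OF h, of n] n by (simp add: algebra_simps)
    \<comment> \<open>The norm of a pair increases with a nonnegative second component, so the
      height may be raised to the arithmetic mean. The pair is then a convex combination and the
      triangle inequality applies.\<close>
    have "norm (v n z w s) \<le> norm (tang c z - n *\<^sub>R w, m1 * (n / s1) + m2 * (n / s2))"
      unfolding v_def norm_Pair using hn n s
      by (intro real_sqrt_le_mono add_left_mono) (simp add: power_mono)
    also have "(tang c z - n *\<^sub>R w, m1 * (n / s1) + m2 * (n / s2)) = m1 *\<^sub>R v n z w1 s1 + m2 *\<^sub>R v n z w2 s2"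
      using comb[of z n] by (simp add: v_def)
    also have "norm \<dots> \<le> m1 * norm (v n z w1 s1) + m2 * norm (v n z w2 s2)"
      using m norm_triangle_ineq[of "m1 *\<^sub>R v n z w1 s1" "m2 *\<^sub>R v n z w2 s2"] by simp
    finally have "sqrt (2 * n) * sqrt (busexp z X / s) \<le>
        sqrt (2 * n) * (m1 * sqrt (busexp z X1 / s1) + m2 * sqrt (busexp z X2 / s2))"
      unfolding sq[symmetric] by (simp add: algebra_simps)
    then show ?thesis by (rule mult_left_le_imp_le) (use n in simp)
  qed
  show thesis
    by (rule that[OF X Xs _ A[unfolded s1_def s2_def] B[unfolded s1_def s2_def]])
      (simp_all add: Xt w_def w1_def w2_def s1_def s2_def)
qed

section \<open>The p-sum of two points\<close>

lemma powr_convex_comb: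
  fixes x y :: real
  assumes "p \<ge> 1" "x > 0" "y > 0" "m1 \<ge> 0" "m2 \<ge> 0" "m1 + m2 = 1"
  shows "(m1 * x + m2 * y) powr p \<le> m1 * x powr p + m2 * y powr p"
proof -
  have m1: "m1 = 1 - m2" using assms by simp
  show ?thesis using convex_onD[OF powr_convex[OF assms(1)], of m2 x y] assms unfolding m1 by simp
qed

text \<open>By homogeneity all values may be divided by those at \<open>c\<close>, which leaves an
  inequality between p-th powers with weights of sum 1. The mean point from
  \<open>horo_mean_points\<close> satisfies it with exponent 1 or 1/2 in place of \<open>p\<close>,
  and convexity of a power function raises the exponent to \<open>p\<close>.\<close>

lemma firey_two_points:
  fixes c :: "'a::euclidean_space"
  assumes X1: "X1 \<in> hyp_space" and X2: "X2 \<in> hyp_space" and c: "norm c = 1"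
    and p: "1 / 2 \<le> p" "p \<le> 2" and ab: "a \<ge> 0" "b \<ge> 0" "a + b \<ge> 1"
  obtains X where "X \<in> hyp_space"
    "busexp c X = (a * busexp c X1 powr p + b * busexp c X2 powr p) powr (1 / p)"
    "\<And>z. norm z = 1 \<Longrightarrow> busexp z X \<le> (a * busexp z X1 powr p + b * busexp z X2 powr p) powr (1 / p)"
proof -
  define s1 where "s1 = busexp c X1"
  define s2 where "s2 = busexp c X2"
  define T where "T = a * s1 powr p + b * s2 powr p"
  define s where "s = T powr (1 / p)"
  \<comment> \<open>the weights for which \<open>(f1, f2) \<mapsto> m1 * f1 / s1 + m2 * f2 / s2\<close> is tangent to
    \<open>((a * f1 powr p + b * f2 powr p) / T) powr (1 / p)\<close> at \<open>(s1, s2)\<close>\<close>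
  define m1 where "m1 = a * s1 powr p / T"
  define m2 where "m2 = b * s2 powr p / T"
  have s12: "s1 > 0" "s2 > 0" using busexp_pos[OF X1 c] busexp_pos[OF X2 c] by (simp_all add: s1_def s2_def)
  have "a > 0 \<or> b > 0" using ab by linarith
  then have T: "T > 0" unfolding T_def using ab s12
    by (auto intro: add_pos_nonneg add_nonneg_pos)
  have s: "s > 0" using T by (simp add: s_def)
  have sp: "s powr p = T" using p T by (simp add: s_def powr_powr)
  have m: "m1 \<ge> 0" "m2 \<ge> 0" "m1 + m2 = 1"
    using ab T by (simp_all add: m1_def m2_def add_divide_distrib[symmetric]) (simp add: T_def)
  have am: "a * f1 powr p + b * f2 powr p = T * (m1 * (f1 / s1) powr p + m2 * (f2 / s2) powr p)"
    if "f1 > 0" "f2 > 0" for f1 f2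
    using T s12 that by (simp add: m1_def m2_def powr_divide algebra_simps)
  \<comment> \<open>power means are monotone; \<open>a + b \<ge> 1\<close> is the case \<open>q = p\<close>\<close>
  have mean: "1 / s powr q \<le> m1 / s1 powr q + m2 / s2 powr q" if q: "q \<ge> p" for q
  proof -
    have "1 \<le> T * (m1 * (1 / s1) powr p + m2 * (1 / s2) powr p)"
      using am[of 1 1] ab by simp
    also have "\<dots> = m1 * (s / s1) powr p + m2 * (s / s2) powr p"
      using s s12 by (simp add: sp[symmetric] powr_divide algebra_simps)
    finally have "1 \<le> (m1 * (s / s1) powr p + m2 * (s / s2) powr p) powr (q / p)"
      using p q by (intro ge_one_powr_ge_zero) auto
    also have "\<dots> \<le> m1 * ((s / s1) powr p) powr (q / p) + m2 * ((s / s2) powr p) powr (q / p)"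
      using p q s s12 m by (intro powr_convex_comb) (auto simp: powr_gt_zero)
    also have "\<dots> = s powr q * (m1 / s1 powr q + m2 / s2 powr q)"
      using p s s12 by (simp add: powr_powr powr_divide algebra_simps)
    finally show ?thesis using s by (simp add: divide_le_eq mult.commute)
  qed
  obtain X where X: "X \<in> hyp_space" "busexp c X = s" and
    A: "\<And>z. \<lbrakk>1 / s\<^sup>2 \<le> m1 / s1\<^sup>2 + m2 / s2\<^sup>2; norm z = 1\<rbrakk> \<Longrightarrow>
       busexp z X / s \<le> m1 * (busexp z X1 / s1) + m2 * (busexp z X2 / s2)" and
    B: "\<And>z. \<lbrakk>1 / s \<le> m1 / s1 + m2 / s2; norm z = 1\<rbrakk> \<Longrightarrow>
       sqrt (busexp z X / s) \<le> m1 * sqrt (busexp z X1 / s1) + m2 * sqrt (busexp z X2 / s2)"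
    using horo_mean_points[OF X1 X2 c m s] unfolding s1_def s2_def by metis
  have "busexp z X \<le> (a * busexp z X1 powr p + b * busexp z X2 powr p) powr (1 / p)"
    if z: "norm z = 1" for z
  proof -
    define f1 where "f1 = busexp z X1"
    define f2 where "f2 = busexp z X2"
    define f where "f = busexp z X"
    have f: "f1 > 0" "f2 > 0" "f > 0"
      using busexp_pos[OF X1 z] busexp_pos[OF X2 z] busexp_pos[OF X(1) z]
      by (simp_all add: f1_def f2_def f_def)
    have key: "(f / s) powr p \<le> m1 * (f1 / s1) powr p + m2 * (f2 / s2) powr p"
    proof (cases "p \<ge> 1")
      case True
      \<comment> \<open>The bound \<open>p \<le> 2\<close> enters here: it allows
        \<open>q = 2\<close> in \<open>mean\<close>.\<close>
      have "1 / s\<^sup>2 \<le> m1 / s1\<^sup>2 + m2 / s2\<^sup>2"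
        using mean[of 2] p s s12 by simp
      from A[OF this z] have "f / s \<le> m1 * (f1 / s1) + m2 * (f2 / s2)"
        by (simp add: f_def f1_def f2_def)
      then have "(f / s) powr p \<le> (m1 * (f1 / s1) + m2 * (f2 / s2)) powr p"
        using p f s by (intro powr_mono2) auto
      also have "\<dots> \<le> m1 * (f1 / s1) powr p + m2 * (f2 / s2) powr p"
        using True f s12 m by (intro powr_convex_comb) auto
      finally show ?thesis .
    next
      case False
      have "1 / s \<le> m1 / s1 + m2 / s2"
        using mean[of 1] False s s12 by simp
      from B[OF this z] have le: "sqrt (f / s) \<le> m1 * sqrt (f1 / s1) + m2 * sqrt (f2 / s2)"
        by (simp add: f_def f1_def f2_def)
      have sqp: "sqrt x powr (2 * p) = x powr p" if "x > 0" for x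
        using that by (simp add: powr_half_sqrt[symmetric] powr_powr)
      have "(f / s) powr p = sqrt (f / s) powr (2 * p)" using f s by (simp add: sqp)
      also have "\<dots> \<le> (m1 * sqrt (f1 / s1) + m2 * sqrt (f2 / s2)) powr (2 * p)"
        using p f s le by (intro powr_mono2) auto
      \<comment> \<open>Convexity of the power with exponent \<open>2 * p\<close>, which is at least
        1 because \<open>p \<ge> 1 / 2\<close>.\<close>
      also have "\<dots> \<le> m1 * sqrt (f1 / s1) powr (2 * p) + m2 * sqrt (f2 / s2) powr (2 * p)"
        using p f s12 m by (intro powr_convex_comb) auto
      also have "\<dots> = m1 * (f1 / s1) powr p + m2 * (f2 / s2) powr p"
        using f s12 by (simp add: sqp)
      finally show ?thesis .
    qed
    have "f powr p = T * (f / s) powr p" using f s T by (simp add: powr_divide sp)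
    also have "\<dots> \<le> T * (m1 * (f1 / s1) powr p + m2 * (f2 / s2) powr p)"
      using key T by (intro mult_left_mono) auto
    also have "\<dots> = a * f1 powr p + b * f2 powr p" using am[OF f(1,2)] by simp
    finally have "(f powr p) powr (1 / p) \<le> (a * f1 powr p + b * f2 powr p) powr (1 / p)"
      using p by (intro powr_mono2) auto
    then show ?thesis using p f by (simp add: powr_powr f_def f1_def f2_def)
  qed
  then show thesis using that X by (simp add: s_def T_def s1_def s2_def)
qed

section \<open>Support functions under the map pi\<close>

lemma pi_map_iff: "y \<in> pi_map \<Omega> \<longleftrightarrow> (\<exists>X\<in>\<Omega>. norm (y + fst X) \<le> snd X)"
  by (force simp: pi_map_def dist_norm norm_minus_commute[of _ y])

text \<open>The support function of the ball contributed by \<open>X\<close> is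
  \<open>z \<mapsto> busexp z X\<close>. This is the upper bound;
  \<open>pi_map_touching_point\<close> gives the point that attains it.\<close>

lemma pi_map_inner_le:
  assumes "norm (y + fst X) \<le> snd X" "norm z = 1" shows "y \<bullet> z \<le> busexp z X"
proof -
  have "(y + fst X) \<bullet> z \<le> snd X"
    using norm_cauchy_schwarz[of "y + fst X" z] assms by simp
  then show ?thesis by (simp add: busexp_def inner_add)
qed

lemma pi_map_touching_point:
  assumes "X \<in> hyp_space" "norm z = 1"
  shows "norm ((snd X *\<^sub>R z - fst X) + fst X) \<le> snd X" "(snd X *\<^sub>R z - fst X) \<bullet> z = busexp z X"
  using assms by (simp_all add: hyp_space_iff busexp_def inner_diff) (simp add: norm_eq_1)

lemma horo_support_attained:
  fixes K :: "('a::euclidean_space \<times> real) set"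
  assumes K: "compact K" "K \<noteq> {}" "K \<subseteq> hyp_space" and z: "norm z = 1"
  obtains X where "X \<in> K" "busexp z X = exp (horo_support K z)"
    "\<And>Y. Y \<in> K \<Longrightarrow> busexp z Y \<le> exp (horo_support K z)"
proof -
  have "continuous_on K (busexp z)"
    unfolding busexp_def by (intro continuous_intros)
  then obtain X where X: "X \<in> K" "\<And>Y. Y \<in> K \<Longrightarrow> busexp z Y \<le> busexp z X"
    using continuous_attains_sup[OF K(1,2)] by blast
  have pos: "busexp z Y > 0" if "Y \<in> K" for Y using busexp_pos[of Y z] K(3) z that by blast
  have "horo_support K z = ln (busexp z X)"
    unfolding horo_support_def mink_null
  proof (intro cSup_eq_maximum)
    show "ln (busexp z X) \<in> (\<lambda>X. ln (busexp z X)) ` K" using X(1) by (rule imageI)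
    show "r \<le> ln (busexp z X)" if r: "r \<in> (\<lambda>X. ln (busexp z X)) ` K" for r
    proof -
      obtain Y where "Y \<in> K" "r = ln (busexp z Y)" using r by (rule imageE)
      then show ?thesis using X pos by simp
    qed
  qed
  then have "exp (horo_support K z) = busexp z X" using pos X(1) by simp
  then show thesis using that X by metis
qed

text \<open>The support function of a union of balls is the supremum of theirs, that is, of
  \<open>busexp z\<close> over \<open>K\<close>. Compactness makes the supremum a maximum, with
  which \<open>exp\<close> and \<open>ln\<close> commute.\<close>

lemma support_fun_pi_map:
  assumes K: "compact K" "K \<noteq> {}" "K \<subseteq> hyp_space" and z: "norm z = 1"
  shows "support_fun (pi_map K) z = exp (horo_support K z)"
proof -
  obtain X where X: "X \<in> K" "busexp z X = exp (horo_support K z)"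
    "\<And>Y. Y \<in> K \<Longrightarrow> busexp z Y \<le> exp (horo_support K z)"
    using horo_support_attained[OF K z] by blast
  have "exp (horo_support K z) \<in> (\<lambda>x. x \<bullet> z) ` pi_map K"
  proof (rule rev_image_eqI)
    show "snd X *\<^sub>R z - fst X \<in> pi_map K"
      unfolding pi_map_iff using pi_map_touching_point(1)[of X z] X(1) K(3) z by blast
    show "exp (horo_support K z) = (snd X *\<^sub>R z - fst X) \<bullet> z"
      using pi_map_touching_point(2)[of X z] X(1,2) K(3) z by auto
  qed
  moreover have "y \<bullet> z \<le> exp (horo_support K z)" if "y \<in> pi_map K" for y
    using that X(3) pi_map_inner_le[OF _ z] unfolding pi_map_iff by (meson order_trans)
  ultimately show ?thesis unfolding support_fun_def by (intro cSup_eq_maximum) auto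
qed

section \<open>Euclidean and horospherical Wulff shapes\<close>

definition wulff :: "('a::euclidean_space \<Rightarrow> real) \<Rightarrow> 'a set" where
  "wulff \<phi> = (\<Inter>z\<in>sphere 0 1. {x. x \<bullet> z \<le> \<phi> z})"

definition horo_wulff :: "('a::euclidean_space \<Rightarrow> real) \<Rightarrow> ('a \<times> real) set" where
  "horo_wulff \<phi> = {X \<in> hyp_space. \<forall>z\<in>sphere 0 1. busexp z X \<le> \<phi> z}"

text \<open>Every constraint is active. Equivalently, \<open>\<phi>\<close> is the exponential of
  the horospherical support function of its own nonempty Wulff shape.\<close>

definition horo_tight :: "('a::euclidean_space \<Rightarrow> real) \<Rightarrow> bool" where
  "horo_tight \<phi> \<longleftrightarrow> (\<forall>z\<in>sphere 0 1. \<exists>X\<in>horo_wulff \<phi>. busexp z X = \<phi> z)"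

lemma closed_hyp_space: "closed (hyp_space :: ('a::euclidean_space \<times> real) set)"
proof -
  \<comment> \<open>The strict sign condition can be replaced by a closed one, since the quadratic
    equation keeps \<open>snd X\<close> away from 0.\<close>
  have eq: "hyp_space = {X :: 'a \<times> real. (snd X)\<^sup>2 = 1 + fst X \<bullet> fst X} \<inter> {X. 0 \<le> snd X}"
  proof (intro equalityI subsetI)
    fix X :: "'a \<times> real"
    assume "X \<in> {X. (snd X)\<^sup>2 = 1 + fst X \<bullet> fst X} \<inter> {X. 0 \<le> snd X}"
    then have X: "(snd X)\<^sup>2 = 1 + fst X \<bullet> fst X" "0 \<le> snd X" by simp_all
    have "(snd X)\<^sup>2 > 0" using X(1) inner_ge_zero[of "fst X"] by linarith
    then have "snd X \<noteq> 0" by auto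
    then show "X \<in> hyp_space" using X by (simp add: hyp_space_iff)
  qed (simp add: hyp_space_iff)
  show ?thesis
    unfolding eq by (intro closed_Int closed_Collect_eq closed_Collect_le continuous_intros)
qed

lemma unit_vector_exists: obtains z :: "'a::euclidean_space" where "norm z = 1"
  using vector_choose_size[of 1] by auto

text \<open>Two horoballs at opposite ideal points already bound the set: adding
  \<open>busexp z X\<close> and \<open>busexp (- z) X\<close> gives \<open>2 * snd X\<close>, which
  dominates \<open>norm (fst X)\<close>.\<close>

lemma compact_horo_wulff: "compact (horo_wulff \<phi>)"
proof -
  obtain z :: 'a where z: "norm z = 1" by (rule unit_vector_exists)
  have "norm X \<le> \<phi> z + \<phi> (- z)" if X: "X \<in> horo_wulff \<phi>" for X
  proof -
    have "busexp z X \<le> \<phi> z" "busexp (- z) X \<le> \<phi> (- z)" using X z by (auto simp: horo_wulff_def)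
    then have "2 * snd X \<le> \<phi> z + \<phi> (- z)" by (simp add: busexp_def)
    moreover have "norm (fst X) < snd X" using X norm_lt_snd[of X] by (simp add: horo_wulff_def)
    moreover have "norm X \<le> norm (fst X) + \<bar>snd X\<bar>" using norm_Pair_le[of "fst X" "snd X"] by simp
    ultimately show ?thesis using norm_ge_zero[of "fst X"] by linarith
  qed
  then have "bounded (horo_wulff \<phi>)" unfolding bounded_iff by blast
  moreover have "closed (horo_wulff \<phi>)"
  proof -
    have eq: "horo_wulff \<phi> = hyp_space \<inter> (\<Inter>z\<in>sphere 0 1. {X. busexp z X \<le> \<phi> z})"
      by (auto simp: horo_wulff_def)
    have "closed {X. busexp z X \<le> \<phi> z}" for z :: 'a
      unfolding busexp_def by (intro closed_Collect_le continuous_intros)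
    then show ?thesis
      unfolding eq by (intro closed_Int closed_hyp_space closed_INT ballI)
  qed
  ultimately show ?thesis by (simp add: compact_eq_bounded_closed)
qed

lemma horo_tight_nonempty: "horo_tight \<phi> \<Longrightarrow> horo_wulff \<phi> \<noteq> {}"
  using unit_vector_exists unfolding horo_tight_def by (metis empty_iff mem_sphere_0)

lemma horo_tight_pos: "horo_tight \<phi> \<Longrightarrow> norm z = 1 \<Longrightarrow> \<phi> z > 0"
  using busexp_pos unfolding horo_tight_def horo_wulff_def by (metis (no_types, lifting) mem_Collect_eq mem_sphere_0)

lemma horo_support_horo_wulff:
  assumes "horo_tight \<phi>" and z: "norm z = 1"
  shows "horo_support (horo_wulff \<phi>) z = ln (\<phi> z)"
proof -
  obtain X where X: "X \<in> horo_wulff \<phi>" "busexp z X = \<phi> z"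
    using assms unfolding horo_tight_def by (metis mem_sphere_0)
  have "busexp z Y \<le> \<phi> z" "busexp z Y > 0" if "Y \<in> horo_wulff \<phi>" for Y
    using that z busexp_pos[of Y z] by (auto simp: horo_wulff_def)
  then have "ln (busexp z Y) \<le> ln (\<phi> z)" if "Y \<in> horo_wulff \<phi>" for Y
    using that by (meson ln_mono)
  then have "r \<le> ln (\<phi> z)" if "r \<in> (\<lambda>Y. ln (busexp z Y)) ` horo_wulff \<phi>" for r
    using that by blast
  moreover have "ln (\<phi> z) \<in> (\<lambda>Y. ln (busexp z Y)) ` horo_wulff \<phi>"
    using X by (intro image_eqI[of _ _ X]) simp_all
  ultimately show ?thesis
    unfolding horo_support_def mink_null by (intro cSup_eq_maximum)
qed

lemma h_convex_horo_wulff: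
  assumes t: "horo_tight \<phi>" shows "h_convex_bounded_domain (horo_wulff \<phi>)"
proof -
  define F where "F = (\<lambda>z. (z, ln (\<phi> z))) ` sphere 0 1"
  have "ln (busexp z X) \<le> ln (\<phi> z) \<longleftrightarrow> busexp z X \<le> \<phi> z" if "X \<in> hyp_space" "norm z = 1" for X z
    using busexp_pos[OF that] horo_tight_pos[OF t that(2)] by simp
  then have "horo_wulff \<phi> = hyp_space \<inter> (\<Inter>(z, s)\<in>F. horoball z s)"
    by (auto simp: F_def horo_wulff_def horoball_def mink_null)
  moreover have "F \<subseteq> sphere 0 1 \<times> UNIV" by (auto simp: F_def)
  ultimately show ?thesis
    unfolding h_convex_bounded_domain_def
    using horo_tight_nonempty[OF t] compact_imp_bounded[OF compact_horo_wulff] by blast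
qed

text \<open>This is the uniqueness behind the definite description in \<open>hyp_p_sum\<close>: each
  horoball in a defining family has level at least the support function, so the family can be
  replaced by the supporting horoballs.\<close>

lemma h_convex_determined_by_support:
  fixes \<Omega> :: "('a::euclidean_space \<times> real) set"
  assumes \<Omega>: "h_convex_bounded_domain \<Omega>" and t: "horo_tight \<phi>"
    and supp: "\<And>z. norm z = 1 \<Longrightarrow> horo_support \<Omega> z = ln (\<phi> z)"
  shows "\<Omega> = horo_wulff \<phi>"
proof -
  obtain F where ne: "\<Omega> \<noteq> {}" and bd: "bounded \<Omega>" and F: "F \<subseteq> sphere 0 1 \<times> UNIV"
    and eq: "\<Omega> = hyp_space \<inter> (\<Inter>(z, s)\<in>F. horoball z s)"
    using \<Omega> by (auto simp: h_convex_bounded_domain_def)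
  have le: "ln (busexp z X) \<le> ln (\<phi> z)" if z: "norm z = 1" and X: "X \<in> \<Omega>" for z X
  proof -
    \<comment> \<open>A real supremum bounds the values only if they are bounded above; boundedness
      of \<open>\<Omega>\<close> supplies that.\<close>
    obtain M where M: "\<And>Y. Y \<in> \<Omega> \<Longrightarrow> norm Y \<le> M" using bd by (auto simp: bounded_iff)
    have "ln (busexp z Y) \<le> ln (M + M)" if Y: "Y \<in> \<Omega>" for Y
    proof -
      have "- (fst Y \<bullet> z) \<le> norm (fst Y)"
        using norm_cauchy_schwarz[of "fst Y" "- z"] z by simp
      moreover have "norm (fst Y) \<le> norm Y" "\<bar>snd Y\<bar> \<le> norm Y"
        using norm_fst_le[of "fst Y" "snd Y"] norm_snd_le[of "snd Y" "fst Y"] by auto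
      ultimately have "busexp z Y \<le> M + M" using M[OF Y] by (simp add: busexp_def)
      moreover have "busexp z Y > 0" using busexp_pos[of Y z] z Y eq by auto
      ultimately show ?thesis by simp
    qed
    then have "bdd_above ((\<lambda>Y. ln (busexp z Y)) ` \<Omega>)" by (rule bdd_aboveI2)
    then have "ln (busexp z X) \<le> horo_support \<Omega> z"
      unfolding horo_support_def mink_null using X by (intro cSUP_upper)
    then show ?thesis using supp[OF z] by simp
  qed
  show ?thesis
  proof
    show "\<Omega> \<subseteq> horo_wulff \<phi>"
    proof
      fix X assume X: "X \<in> \<Omega>"
      then have H: "X \<in> hyp_space" using eq by blast
      have "busexp z X \<le> \<phi> z" if "norm z = 1" for z
        using le[OF that X] busexp_pos[OF H that] horo_tight_pos[OF t that] by simp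
      then show "X \<in> horo_wulff \<phi>" using H by (simp add: horo_wulff_def)
    qed
    show "horo_wulff \<phi> \<subseteq> \<Omega>"
    proof
      fix X assume X: "X \<in> horo_wulff \<phi>"
      then have H: "X \<in> hyp_space" by (simp add: horo_wulff_def)
      have "X \<in> horoball z s" if zs: "(z, s) \<in> F" for z s
      proof -
        have z: "norm z = 1" using zs F by auto
        have "ln (busexp z Y) \<le> s" if "Y \<in> \<Omega>" for Y
          using that zs unfolding eq by (auto simp: horoball_def mink_null)
        then have "horo_support \<Omega> z \<le> s"
          unfolding horo_support_def mink_null using ne by (intro cSUP_least)
        then have "ln (\<phi> z) \<le> s" using supp[OF z] by simp
        moreover have "ln (busexp z X) \<le> ln (\<phi> z)"
          using X z busexp_pos[OF H z] horo_tight_pos[OF t z] by (auto simp: horo_wulff_def)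
        ultimately show ?thesis using H by (simp add: horoball_def mink_null)
      qed
      then show "X \<in> \<Omega>" using H by (auto simp: eq)
    qed
  qed
qed

section \<open>Compactness and convexity of the image under pi\<close>

lemma compact_pi_map:
  fixes \<Omega> :: "('a::euclidean_space \<times> real) set"
  assumes "compact \<Omega>" "\<Omega> \<subseteq> hyp_space" shows "compact (pi_map \<Omega>)"
proof -
  have "pi_map \<Omega> = (\<lambda>(X, v). snd X *\<^sub>R v - fst X) ` (\<Omega> \<times> cball 0 1)" (is "_ = ?f ` _")
  proof (intro equalityI subsetI)
    fix y assume "y \<in> pi_map \<Omega>"
    then obtain X where X: "X \<in> \<Omega>" "norm (y + fst X) \<le> snd X" by (auto simp: pi_map_iff)
    have "snd X > 0" using X assms by (auto simp: hyp_space_iff)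
    then have "y = ?f (X, (1 / snd X) *\<^sub>R (y + fst X))" "(1 / snd X) *\<^sub>R (y + fst X) \<in> cball 0 1"
      using X by simp_all
    then show "y \<in> ?f ` (\<Omega> \<times> cball 0 1)" using X by blast
  next
    fix y assume "y \<in> ?f ` (\<Omega> \<times> cball 0 1)"
    then obtain X v where X: "X \<in> \<Omega>" "norm v \<le> 1" "y = snd X *\<^sub>R v - fst X" by auto
    have "snd X > 0" using X assms by (auto simp: hyp_space_iff)
    then show "y \<in> pi_map \<Omega>" using X unfolding pi_map_iff by (intro bexI[of _ X]) (auto simp: mult_left_le)
  qed
  moreover have "compact (?f ` (\<Omega> \<times> cball 0 1))"
    using assms unfolding case_prod_beta
    by (intro compact_continuous_image continuous_intros compact_Times compact_cball)
  ultimately show ?thesis by simp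
qed

text \<open>Equality in Cauchy-Schwarz forces \<open>y + fst X = snd X *\<^sub>R z\<close>. In this
  form a contact point with fixed \<open>busexp z X\<close> depends affinely on the tangential part
  of \<open>X\<close>.\<close>

lemma pi_map_contact:
  assumes X: "X \<in> hyp_space" and z: "norm z = 1"
    and y: "norm (y + fst X) \<le> snd X" "y \<bullet> z = busexp z X"
  shows "y = busexp z X *\<^sub>R z - tang z (fst X)"
proof -
  have zz: "z \<bullet> z = 1" using z by (simp add: norm_eq_1)
  have yz: "(y + fst X) \<bullet> z = snd X" using y(2) by (simp add: busexp_def inner_add)
  have "(norm (y + fst X - snd X *\<^sub>R z))\<^sup>2 = (norm (y + fst X))\<^sup>2 - (snd X)\<^sup>2"
    unfolding power2_norm_eq_inner inner_diff_left inner_diff_right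
    by (simp only: inner_scaleR_left inner_scaleR_right inner_commute[of z "y + fst X"] yz zz)
      (simp add: power2_eq_square)
  also have "\<dots> \<le> 0" using power_mono[OF y(1) norm_ge_zero, of 2] by simp
  finally have "y + fst X - snd X *\<^sub>R z = 0" by simp
  then have "y = snd X *\<^sub>R z - fst X" by (metis add_diff_cancel_right' eq_iff_diff_eq_0)
  then show ?thesis by (simp add: busexp_def tang_def algebra_simps)
qed

lemma convex_pi_map_face:
  fixes \<phi> :: "'a::euclidean_space \<Rightarrow> real"
  assumes c: "norm c = 1"
  shows "convex (pi_map (horo_wulff \<phi>) \<inter> {y. c \<bullet> y = \<phi> c})"
proof (rule convexI)
  fix y1 y2 :: 'a and m1 m2 :: real
  assume m: "0 \<le> m1" "0 \<le> m2" "m1 + m2 = 1"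
    and "y1 \<in> pi_map (horo_wulff \<phi>) \<inter> {y. c \<bullet> y = \<phi> c}" "y2 \<in> pi_map (horo_wulff \<phi>) \<inter> {y. c \<bullet> y = \<phi> c}"
  then obtain X1 X2 where X: "X1 \<in> horo_wulff \<phi>" "X2 \<in> horo_wulff \<phi>"
    and n: "norm (y1 + fst X1) \<le> snd X1" "norm (y2 + fst X2) \<le> snd X2"
    and e: "y1 \<bullet> c = \<phi> c" "y2 \<bullet> c = \<phi> c" by (auto simp: pi_map_iff inner_commute)
  have H: "X1 \<in> hyp_space" "X2 \<in> hyp_space" using X by (auto simp: horo_wulff_def)
  have "busexp c X1 \<le> \<phi> c" "busexp c X2 \<le> \<phi> c" using X c by (auto simp: horo_wulff_def)
  then have b: "busexp c X1 = \<phi> c" "busexp c X2 = \<phi> c"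
    using pi_map_inner_le[OF n(1) c] pi_map_inner_le[OF n(2) c] e by auto
  define s where "s = \<phi> c"
  have s: "s > 0" using busexp_pos[OF H(1) c] b by (simp add: s_def)
  have y: "y1 = s *\<^sub>R c - tang c (fst X1)" "y2 = s *\<^sub>R c - tang c (fst X2)"
    using pi_map_contact[OF H(1) c n(1)] pi_map_contact[OF H(2) c n(2)] b e by (simp_all add: s_def)
  obtain X where X0: "X \<in> hyp_space" "busexp c X = s"
    and tX: "tang c (fst X) =
       s *\<^sub>R ((m1 / busexp c X1) *\<^sub>R tang c (fst X1) + (m2 / busexp c X2) *\<^sub>R tang c (fst X2))"
    and le: "\<And>z. \<lbrakk>1 / s\<^sup>2 \<le> m1 / (busexp c X1)\<^sup>2 + m2 / (busexp c X2)\<^sup>2; norm z = 1\<rbrakk> \<Longrightarrow>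
       busexp z X / s \<le> m1 * (busexp z X1 / busexp c X1) + m2 * (busexp z X2 / busexp c X2)"
    using horo_mean_points[OF H c m s] by metis
  have bs: "busexp c X1 = s" "busexp c X2 = s" using b by (simp_all add: s_def)
  have "X \<in> horo_wulff \<phi>"
  proof -
    have "busexp z X \<le> \<phi> z" if z: "norm z = 1" for z
    proof -
      \<comment> \<open>Both contact points lie on the horosphere of level \<open>s\<close>, so the
        height condition holds with equality and the mean point stays on that horosphere.\<close>
      have "1 / s\<^sup>2 \<le> m1 / s\<^sup>2 + m2 / s\<^sup>2" using m(3) by (simp add: add_divide_distrib[symmetric])
      then have "busexp z X / s \<le> (m1 * busexp z X1 + m2 * busexp z X2) / s"
        using le[of z] z by (simp add: bs add_divide_distrib)
      then have "busexp z X \<le> m1 * busexp z X1 + m2 * busexp z X2"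
        using s by (simp add: divide_le_cancel)
      also have "\<dots> \<le> m1 * \<phi> z + m2 * \<phi> z"
        using m X z by (intro add_mono mult_left_mono) (auto simp: horo_wulff_def)
      also have "\<dots> = \<phi> z" using m(3) by (simp add: distrib_right[symmetric])
      finally show ?thesis .
    qed
    then show ?thesis using X0 by (simp add: horo_wulff_def)
  qed
  moreover have "m1 *\<^sub>R y1 + m2 *\<^sub>R y2 = snd X *\<^sub>R c - fst X"
  proof -
    have "m1 *\<^sub>R y1 + m2 *\<^sub>R y2 = (m1 + m2) *\<^sub>R (s *\<^sub>R c) - (m1 *\<^sub>R tang c (fst X1) + m2 *\<^sub>R tang c (fst X2))"
      unfolding y by (simp add: algebra_simps)
    also have "\<dots> = s *\<^sub>R c - tang c (fst X)"
      using s m(3) by (simp add: tX bs algebra_simps)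
    also have "\<dots> = snd X *\<^sub>R c - fst X"
      using X0(2) by (simp add: busexp_def tang_def algebra_simps)
    finally show ?thesis .
  qed
  ultimately show "m1 *\<^sub>R y1 + m2 *\<^sub>R y2 \<in> pi_map (horo_wulff \<phi>) \<inter> {y. c \<bullet> y = \<phi> c}"
    using pi_map_touching_point[OF X0(1) c] X0(2) unfolding pi_map_iff Int_iff mem_Collect_eq
    by (metis inner_commute s_def)
qed

text \<open>Each ball in the union contains the origin, because \<open>norm (fst X) < snd X\<close>
  on the hyperboloid.\<close>

lemma pi_map_starlike:
  assumes "\<Omega> \<subseteq> hyp_space" "y \<in> pi_map \<Omega>" "0 \<le> r" "r \<le> 1" shows "r *\<^sub>R y \<in> pi_map \<Omega>"
proof -
  obtain X where X: "X \<in> \<Omega>" "y \<in> cball (- fst X) (snd X)"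
    using assms(2) by (auto simp: pi_map_def)
  have "0 \<in> cball (- fst X) (snd X)" using norm_lt_snd[of X] X assms by auto
  then have "(1 - r) *\<^sub>R 0 + r *\<^sub>R y \<in> cball (- fst X) (snd X)"
    using X assms by (intro convexD[OF convex_cball]) auto
  then show ?thesis using X(1) by (force simp: pi_map_def)
qed

lemma unit_separation:
  fixes C :: "'a::euclidean_space set"
  assumes "compact C" "convex C" "C \<noteq> {}" "y \<notin> C"
  obtains z where "norm z = 1" "\<And>x. x \<in> C \<Longrightarrow> x \<bullet> z < y \<bullet> z"
proof -
  obtain w d where w: "w \<bullet> y < d" "\<And>x. x \<in> C \<Longrightarrow> w \<bullet> x > d"
    using separating_hyperplane_closed_point[OF assms(2) compact_imp_closed[OF assms(1)] assms(4)] by blast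
  have "w \<noteq> 0" using w assms(3) by force
  define z where "z = (- 1 / norm w) *\<^sub>R w"
  have "norm z = 1" using \<open>w \<noteq> 0\<close> by (simp add: z_def)
  moreover have "x \<bullet> z < y \<bullet> z" if "x \<in> C" for x
  proof -
    have "w \<bullet> y < w \<bullet> x" using w that by force
    then show ?thesis using \<open>w \<noteq> 0\<close> by (simp add: z_def inner_commute divide_strict_right_mono)
  qed
  ultimately show thesis using that by blast
qed

lemma wulff_subset_convex_body:
  fixes C :: "'a::euclidean_space set"
  assumes "compact C" "convex C" "C \<noteq> {}"
    and "\<And>z. norm z = 1 \<Longrightarrow> \<exists>x\<in>C. \<phi> z \<le> x \<bullet> z"
  shows "wulff \<phi> \<subseteq> C"
proof
  fix y assume y: "y \<in> wulff \<phi>"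
  show "y \<in> C"
  proof (rule ccontr)
    assume "y \<notin> C"
    then obtain z where "norm z = 1" "\<And>x. x \<in> C \<Longrightarrow> x \<bullet> z < y \<bullet> z"
      using unit_separation[OF assms(1-3)] by blast
    then show False using assms(4)[of z] y by (force simp: wulff_def)
  qed
qed

lemma pi_map_horo_wulff_hull:
  fixes \<phi> :: "'a::euclidean_space \<Rightarrow> real"
  assumes t: "horo_tight \<phi>"
  shows "convex hull (pi_map (horo_wulff \<phi>)) = pi_map (horo_wulff \<phi>)"
proof -
  define P where "P = pi_map (horo_wulff \<phi>)"
  define D where "D = convex hull P"
  have H: "horo_wulff \<phi> \<subseteq> hyp_space" by (auto simp: horo_wulff_def)
  have cP: "compact P" unfolding P_def by (rule compact_pi_map[OF compact_horo_wulff H])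
  have cD: "compact D" "convex D" unfolding D_def using cP by (auto intro: compact_convex_hull)
  have PD: "P \<subseteq> D" by (simp add: D_def hull_subset)
  have le: "z \<bullet> y \<le> \<phi> z" if "y \<in> D" "norm z = 1" for y z
  proof -
    have "P \<subseteq> {y. z \<bullet> y \<le> \<phi> z}"
    proof
      fix x assume "x \<in> P"
      then obtain X where X: "X \<in> horo_wulff \<phi>" "norm (x + fst X) \<le> snd X"
        unfolding P_def pi_map_iff by blast
      have "busexp z X \<le> \<phi> z" using X(1) that(2) by (simp add: horo_wulff_def)
      then show "x \<in> {y. z \<bullet> y \<le> \<phi> z}"
        using pi_map_inner_le[OF X(2) that(2)] by (simp add: inner_commute)
    qed
    then have "D \<subseteq> {y. z \<bullet> y \<le> \<phi> z}" unfolding D_def by (simp add: hull_minimal convex_halfspace_le)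
    then show ?thesis using that by blast
  qed
  have "interior D \<noteq> {}"
  proof -
    obtain X where X: "X \<in> horo_wulff \<phi>" using horo_tight_nonempty[OF t] by blast
    then have "cball (- fst X) (snd X) \<subseteq> D" using PD by (force simp: P_def pi_map_def)
    then have "ball (- fst X) (snd X) \<subseteq> interior D"
      using ball_subset_cball by (intro interior_maximal) auto
    moreover have "snd X > 0" using X by (auto simp: horo_wulff_def hyp_space_iff)
    ultimately show ?thesis by (metis centre_in_ball empty_iff subsetD)
  qed
  \<comment> \<open>With interior points present, the relative frontier in the supporting hyperplane
    theorem is the ordinary one.\<close>
  then have ri: "rel_interior D = interior D" by (rule rel_interior_nonempty_interior)
  have bdry: "y \<in> P" if y: "y \<in> D" "y \<notin> interior D" for y
  proof -
    obtain w where w: "w \<noteq> 0" "\<And>x. x \<in> closure D \<Longrightarrow> w \<bullet> y \<le> w \<bullet> x"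
      using supporting_hyperplane_relative_frontier[of D y] cD y ri closure_subset by (metis subsetD)
    define z where "z = (- 1 / norm w) *\<^sub>R w"
    have z: "norm z = 1" using w by (simp add: z_def)
    have zD: "z \<bullet> x \<le> z \<bullet> y" if "x \<in> D" for x
      using w(1) w(2)[of x] that closure_subset[of D] by (auto simp: z_def divide_right_mono)
    \<comment> \<open>Tightness identifies the supporting level: some point of \<open>P\<close>
      reaches \<open>\<phi> z\<close> in direction \<open>z\<close>, so \<open>y\<close> does
      too.\<close>
    obtain X where X: "X \<in> horo_wulff \<phi>" "busexp z X = \<phi> z"
      using t z unfolding horo_tight_def by (metis mem_sphere_0)
    have "snd X *\<^sub>R z - fst X \<in> D" "(snd X *\<^sub>R z - fst X) \<bullet> z = \<phi> z"
    proof -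
      have XH: "X \<in> hyp_space" using X(1) H by blast
      have "snd X *\<^sub>R z - fst X \<in> P"
        unfolding P_def pi_map_iff using pi_map_touching_point(1)[OF XH z] X(1) by blast
      then show "snd X *\<^sub>R z - fst X \<in> D" using PD by blast
      show "(snd X *\<^sub>R z - fst X) \<bullet> z = \<phi> z" using pi_map_touching_point(2)[OF XH z] X(2) by simp
    qed
    then have "\<phi> z \<le> z \<bullet> y" using zD by (metis inner_commute)
    then have yz: "z \<bullet> y = \<phi> z" using le[OF y(1) z] by simp
    \<comment> \<open>A face of the hull of a compact set is the hull of some points of that set.
      Here these lie in the contact part of \<open>P\<close>, which is convex, so the face stays
      inside \<open>P\<close>.\<close>
    have "(D \<inter> {x. z \<bullet> x = \<phi> z}) face_of D"
      using le z cD by (intro face_of_Int_supporting_hyperplane_le) auto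
    then obtain S where S: "S \<subseteq> P" "D \<inter> {x. z \<bullet> x = \<phi> z} = convex hull S"
      unfolding D_def using face_of_convex_hull_subset[OF cP] by metis
    have "S \<subseteq> P \<inter> {x. z \<bullet> x = \<phi> z}" using S hull_subset[of S convex] by auto
    then have "convex hull S \<subseteq> P \<inter> {x. z \<bullet> x = \<phi> z}"
      unfolding P_def by (rule hull_minimal) (rule convex_pi_map_face[OF z])
    then show ?thesis using y yz S by auto
  qed
  have "y \<in> P" if y: "y \<in> D" for y
  proof (cases "y \<in> interior D \<and> y \<noteq> 0")
    case True
    \<comment> \<open>An interior point is a shrunken copy of the frontier point on its ray from the
      origin, so star-shapedness brings it back into \<open>P\<close>.\<close>
    then obtain d where d: "d > 0" "y + d *\<^sub>R y \<in> frontier D"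
      using ray_to_frontier[OF compact_imp_bounded[OF cD(1)], of y y] by metis
    then have "y + d *\<^sub>R y \<in> P"
      using bdry compact_imp_closed[OF cD(1)] by (simp add: frontier_def)
    then have "(1 / (1 + d)) *\<^sub>R (y + d *\<^sub>R y) \<in> P"
      unfolding P_def using d by (intro pi_map_starlike[OF H]) auto
    moreover have "y + d *\<^sub>R y = (1 + d) *\<^sub>R y" by (simp add: algebra_simps)
    ultimately show ?thesis using d by simp
  next
    case False
    obtain X where X: "X \<in> horo_wulff \<phi>" using horo_tight_nonempty[OF t] by blast
    then have "norm (0 + fst X) \<le> snd X" using norm_lt_snd[of X] H by auto
    then have "0 \<in> P" unfolding P_def pi_map_iff using X by blast
    then show ?thesis using False bdry y by blast
  qed
  then show ?thesis using PD by (auto simp: P_def D_def)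
qed

lemma convex_body_pi_map_horo_wulff:
  assumes t: "horo_tight \<phi>"
  shows "convex_body (pi_map (horo_wulff \<phi>))"
proof -
  have "horo_wulff \<phi> \<subseteq> hyp_space" by (auto simp: horo_wulff_def)
  moreover have "pi_map (horo_wulff \<phi>) \<noteq> {}"
  proof -
    obtain X where X: "X \<in> horo_wulff \<phi>" using horo_tight_nonempty[OF t] by blast
    then have "- fst X \<in> pi_map (horo_wulff \<phi>)"
      unfolding pi_map_iff by (intro bexI[of _ X]) (auto simp: horo_wulff_def hyp_space_iff)
    then show ?thesis by blast
  qed
  ultimately show ?thesis
    unfolding convex_body_def using compact_pi_map[OF compact_horo_wulff] pi_map_horo_wulff_hull[OF t]
    by (metis convex_convex_hull)
qed

section \<open>Convex bodies and their support functions\<close>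

lemma support_fun_attained:
  fixes C :: "'a::euclidean_space set"
  assumes "compact C" "C \<noteq> {}"
  obtains x where "x \<in> C" "x \<bullet> z = support_fun C z" "\<And>y. y \<in> C \<Longrightarrow> y \<bullet> z \<le> support_fun C z"
proof -
  obtain x where x: "x \<in> C" "\<And>y. y \<in> C \<Longrightarrow> y \<bullet> z \<le> x \<bullet> z"
    using continuous_attains_sup[OF assms continuous_on_inner[OF continuous_on_id continuous_on_const], of z]
    by blast
  then have "support_fun C z = x \<bullet> z"
    unfolding support_fun_def by (intro cSup_eq_maximum) auto
  then show thesis using that x by metis
qed

text \<open>By separation, a convex body is the intersection of its supporting half-spaces. This
  serves both branches of \<open>firey_sum\<close>: uniqueness for \<open>p \<ge> 1\<close> and the
  intersection formula for \<open>p < 1\<close>.\<close>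

lemma convex_body_eq_wulff:
  fixes C :: "'a::euclidean_space set"
  assumes C: "convex_body C" and s: "\<And>z. norm z = 1 \<Longrightarrow> support_fun C z = \<phi> z"
  shows "C = wulff \<phi>"
proof
  have C': "compact C" "convex C" "C \<noteq> {}" using C by (auto simp: convex_body_def)
  have "y \<bullet> z \<le> \<phi> z" if y: "y \<in> C" and z: "norm z = 1" for y z
    by (rule support_fun_attained[OF C'(1,3), of z]) (use y s[OF z] in simp)
  then show "C \<subseteq> wulff \<phi>" by (auto simp: wulff_def)
  have "\<exists>x\<in>C. \<phi> z \<le> x \<bullet> z" if z: "norm z = 1" for z
    by (rule support_fun_attained[OF C'(1,3), of z]) (use s[OF z] in force)
  then show "wulff \<phi> \<subseteq> C" by (rule wulff_subset_convex_body[OF C'])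
qed

lemma smooth_or_point_compact:
  assumes "(smooth_bounded_domain K \<and> uniformly_h_convex K) \<or> (\<exists>X\<in>hyp_space. K = {X})"
  shows "compact K" "K \<noteq> {}" "K \<subseteq> hyp_space"
  using assms by (auto simp: smooth_bounded_domain_def)

theorem theorem12p2:
  fixes n :: nat and p a b :: real and K L \<Omega> :: "('a::euclidean_space \<times> real) set"
  assumes "n \<ge> 1" and "DIM('a) = n + 1"
    and "1 / 2 \<le> p" and "p \<le> 2" and "a \<ge> 0" and "b \<ge> 0" and "a + b \<ge> 1"
    and "(smooth_bounded_domain K \<and> uniformly_h_convex K) \<or> (\<exists>X\<in>hyp_space. K = {X})"
    and "(smooth_bounded_domain L \<and> uniformly_h_convex L) \<or> (\<exists>X\<in>hyp_space. L = {X})"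
    and "\<Omega> = hyp_p_sum p a K b L"
  shows "pi_map \<Omega> = firey_sum p a (pi_map K) b (pi_map L)"
proof -
  note K = smooth_or_point_compact[OF assms(8)] and L = smooth_or_point_compact[OF assms(9)]
  define uK where "uK z = exp (horo_support K z)" for z
  define uL where "uL z = exp (horo_support L z)" for z
  define \<phi> where "\<phi> z = (a * uK z powr p + b * uL z powr p) powr (1 / p)" for z
  have sum_pos: "a * uK z powr p + b * uL z powr p > 0" for z
  proof -
    have "uK z powr p > 0" "uL z powr p > 0" by (simp_all add: uK_def uL_def)
    moreover have "a > 0 \<or> b > 0" using assms(7) by linarith
    ultimately show ?thesis
      using assms(5,6) by (meson add_nonneg_pos add_pos_nonneg mult_nonneg_nonneg mult_pos_pos less_imp_le)
  qed
  have tight: "horo_tight \<phi>"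
    unfolding horo_tight_def
  proof
    fix c :: 'a assume "c \<in> sphere 0 1"
    then have c: "norm c = 1" by simp
    obtain X1 where X1: "X1 \<in> K" "busexp c X1 = uK c"
      using horo_support_attained[OF K c] unfolding uK_def by metis
    obtain X2 where X2: "X2 \<in> L" "busexp c X2 = uL c"
      using horo_support_attained[OF L c] unfolding uL_def by metis
    have H: "X1 \<in> hyp_space" "X2 \<in> hyp_space" using X1 X2 K L by auto
    obtain X where X: "X \<in> hyp_space" "busexp c X = \<phi> c"
      "\<And>z. norm z = 1 \<Longrightarrow> busexp z X \<le> (a * busexp z X1 powr p + b * busexp z X2 powr p) powr (1 / p)"
      using firey_two_points[OF H c assms(3-7)] X1 X2 unfolding \<phi>_def by metis
    have "busexp z X \<le> \<phi> z" if z: "norm z = 1" for z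
    proof -
      have "busexp z X1 \<le> uK z" "busexp z X2 \<le> uL z"
        using horo_support_attained[OF K z] horo_support_attained[OF L z] X1 X2
        unfolding uK_def uL_def by metis+
      moreover have "busexp z X1 > 0" "busexp z X2 > 0" using busexp_pos H z by blast+
      \<comment> \<open>Monotonicity of the p-sum: the contact points match \<open>uK\<close> and
        \<open>uL\<close> at \<open>c\<close> and are bounded by them in every direction.\<close>
      ultimately have "(a * busexp z X1 powr p + b * busexp z X2 powr p) powr (1 / p) \<le> \<phi> z"
        unfolding \<phi>_def using assms(3,5,6)
        by (intro powr_mono2 add_mono mult_left_mono add_nonneg_nonneg) auto
      then show ?thesis using X(3)[OF z] by linarith
    qed
    then have "X \<in> horo_wulff \<phi>" using X(1) by (simp add: horo_wulff_def)
    then show "\<exists>X\<in>horo_wulff \<phi>. busexp c X = \<phi> c" using X(2) by blast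
  qed
  have ln_\<phi>: "1 / p * ln (a * exp (p * horo_support K z) + b * exp (p * horo_support L z)) = ln (\<phi> z)" for z
    using sum_pos[of z] by (simp add: \<phi>_def uK_def uL_def powr_def mult.commute)
  have "\<Omega> = horo_wulff \<phi>"
    unfolding assms(10) hyp_p_sum_def ln_\<phi>
  proof (rule the_equality)
    show "h_convex_bounded_domain (horo_wulff \<phi>) \<and>
        (\<forall>z\<in>sphere 0 1. horo_support (horo_wulff \<phi>) z = ln (\<phi> z))"
      using h_convex_horo_wulff[OF tight] horo_support_horo_wulff[OF tight] by simp
  next
    fix \<Omega>' :: "('a \<times> real) set"
    assume "h_convex_bounded_domain \<Omega>' \<and> (\<forall>z\<in>sphere 0 1. horo_support \<Omega>' z = ln (\<phi> z))"
    then show "\<Omega>' = horo_wulff \<phi>" using h_convex_determined_by_support[OF _ tight] by simp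
  qed
  moreover define C where "C = pi_map (horo_wulff \<phi>)"
  moreover have body: "convex_body C"
    unfolding C_def by (rule convex_body_pi_map_horo_wulff[OF tight])
  moreover have supp: "support_fun C z = \<phi> z" if z: "norm z = 1" for z
  proof -
    have "horo_wulff \<phi> \<subseteq> hyp_space" by (auto simp: horo_wulff_def)
    then show ?thesis
      unfolding C_def
      using support_fun_pi_map[OF compact_horo_wulff horo_tight_nonempty[OF tight] _ z]
        horo_support_horo_wulff[OF tight z] horo_tight_pos[OF tight z] by simp
  qed
  moreover have "firey_sum p a (pi_map K) b (pi_map L) = C"
  proof -
    have \<phi>: "(a * support_fun (pi_map K) z powr p + b * support_fun (pi_map L) z powr p) powr (1 / p) = \<phi> z"
      if "z \<in> sphere 0 1" for z
      using that by (simp add: \<phi>_def uK_def uL_def support_fun_pi_map[OF K] support_fun_pi_map[OF L])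
    \<comment> \<open>Since \<open>\<phi>\<close> is the support function of the convex body
      \<open>C\<close>, the Wulff shape and the body described by \<open>THE\<close>
      coincide.\<close>
    have C: "C = wulff \<phi>" using convex_body_eq_wulff[OF body] supp by blast
    have "(THE D. convex_body D \<and> (\<forall>z\<in>sphere 0 1. support_fun D z = \<phi> z)) = C"
    proof (rule the_equality)
      show "convex_body C \<and> (\<forall>z\<in>sphere 0 1. support_fun C z = \<phi> z)" using body supp by simp
    next
      fix D :: "'a set"
      assume "convex_body D \<and> (\<forall>z\<in>sphere 0 1. support_fun D z = \<phi> z)"
      then show "D = C" using convex_body_eq_wulff[of D \<phi>] C by simp
    qed
    moreover have "firey_sum p a (pi_map K) b (pi_map L) =
        (if p \<ge> 1 then THE D. convex_body D \<and> (\<forall>z\<in>sphere 0 1. support_fun D z = \<phi> z) else wulff \<phi>)"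
      unfolding firey_sum_def wulff_def by (simp only: \<phi> cong: ball_cong INF_cong)
    ultimately show ?thesis using C by simp
  qed
  ultimately show ?thesis by simp
qed

end
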